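(* Let $q$ be a prime power, $\mathbb{A}=\mathbb{F}_q[t]$, and let $g\in\mathbb{A}$ be a non-constant polynomial. Then $(g,g)$ is a Chen pair if and only if one of the following holds: (1) $q=2$, $t^3\nmid g$, $(t+1)^3\nmid g$, and $P^2\nmid g$ for every irreducible polynomial $P\in\mathbb{A}$ with $\deg P\ge 2$; or (2) $q>2$ and $g$ is square-free.
   Context: $\mathbb{F}_q$ is the finite field with $q$ elements and $\mathbb{A}=\mathbb{F}_q[t]$. For a non-constant $f\in\mathbb{A}$, $\mathbb{A}_f=\mathbb{A}/f\mathbb{A}$ is the residue class ring modulo $f$, and $\mathcal{A}_f=\{h\in\mathbb{A}:\deg h<\deg f\}\cup\{0\}$, a complete set of representatives of the residue classes modulo $f$; for $h\in\mathcal{A}_f$, $\bar h$ denotes the residue class of $h$ modulo $f$. Let $f,g\in\mathbb{A}$ be non-constant. A function $\sigma:\mathbb{A}_f\to\mathbb{A}_g$ is a polynomial function if there is $F\in\mathbb{A}[x]$ such that $\sigma(\bar h)=F(h)\bmod g$ for all $h\in\mathcal{A}_f$. A function $\sigma:\mathbb{A}_f\to\mathbb{A}_g$ is called congruence preserving if for all $h_1,h_2\in\mathcal{A}_f$ and every $h\in\mathbb{A}$ dividing $g$, $h_1\equiv h_2\pmod h$ implies $\sigma(\bar h_1)\equiv\sigma(\bar h_2)\pmod h$ (here $h_1,h_2$ are regarded as elements of $\mathbb{A}$, and reduction modulo $h$ of elements of $\mathbb{A}_g$ is well defined since $h\mid g$). $(f,g)$ is a Chen pair if every congruence preserving function from $\mathbb{A}_f$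 to $\mathbb{A}_g$ is a polynomial function. *)

theory Defs
  imports "HOL-Computational_Algebra.Computational_Algebra"
    "HOL-Number_Theory.Cong"
    "HOL-Library.Cardinality"
    "HOL-Library.FuncSet"
begin

text \<open>
  The ring \<open>\<bbbA> = \<bbbF>\<^sub>q[t]\<close> is \<open>'a poly\<close> for a finite field \<open>'a\<close> with \<open>q = CARD('a)\<close>;
  the variable \<open>t\<close> is \<open>[:0, 1:]\<close>. The definitions below are meant for non-constant moduli
  \<open>f\<close> and \<open>g\<close>.
\<close>

definition residue_class :: "'a::field poly \<Rightarrow> 'a poly \<Rightarrow> 'a poly set" where
  "residue_class f h = {k. [k = h] (mod f)}"

text \<open>Only the underlying set of the residue class ring \<open>\<bbbA>\<^sub>f\<close> is needed.\<close>

definition residue_classes :: "'a::field poly \<Rightarrow> 'a poly set set" where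
  "residue_classes f = range (residue_class f)"

definition reps :: "'a::field poly \<Rightarrow> 'a poly set" where
  "reps f = {h. degree h < degree f} \<union> {0}"

definition polynomial_function ::
    "'a::field poly \<Rightarrow> 'a poly \<Rightarrow> ('a poly set \<Rightarrow> 'a poly set) \<Rightarrow> bool" where
  "polynomial_function f g \<sigma> \<longleftrightarrow>
     (\<exists>F :: 'a poly poly. \<forall>h\<in>reps f. \<sigma> (residue_class f h) = residue_class g (poly F h))"

text \<open>
  Classes modulo \<open>g\<close> are compared modulo a divisor \<open>d\<close> of \<open>g\<close> through their representatives
  \<open>u\<close>, \<open>v\<close>; as \<open>d dvd g\<close>, the choice of representatives does not matter.
\<close>

definition congruence_preserving ::
    "'a::field poly \<Rightarrow> 'a poly \<Rightarrow> ('a poly set \<Rightarrow> 'a poly set) \<Rightarrow> bool" where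
  "congruence_preserving f g \<sigma> \<longleftrightarrow>
     (\<forall>h1\<in>reps f. \<forall>h2\<in>reps f. \<forall>d. d dvd g \<longrightarrow> [h1 = h2] (mod d) \<longrightarrow>
        (\<forall>u\<in>\<sigma> (residue_class f h1). \<forall>v\<in>\<sigma> (residue_class f h2). [u = v] (mod d)))"

definition Chen_pair :: "'a::field poly \<Rightarrow> 'a poly \<Rightarrow> bool" where
  "Chen_pair f g \<longleftrightarrow>
     (\<forall>\<sigma> \<in> residue_classes f \<rightarrow> residue_classes g.
        congruence_preserving f g \<sigma> \<longrightarrow> polynomial_function f g \<sigma>)"

end

theory Submission
  imports Defs
begin

text \<open>
  By the Chinese remainder theorem one may pass to the prime powers \<open>P ^ k\<close> exactly dividing \<open>g\<close>.
  Modulo \<open>P\<close> every function is polynomial by Lagrange interpolation. If the residue field of \<open>P\<close>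
  is \<open>{0, 1}\<close>, then modulo \<open>P\<^sup>2\<close> there are only the residues \<open>0, 1, P, 1 + P\<close>, and a congruence
  preserving function is interpolated at them with the Newton basis
  \<open>1, x, x (x - 1), x (x - 1) (x - P)\<close>. In all other cases the multiple \<open>P ^ (k - 1)\<close> of the
  indicator function of the class of \<open>P ^ (k - 1)\<close> is congruence preserving, but its first-order
  behaviour is incompatible with the Taylor expansion of a polynomial.
\<close>

text \<open>The case \<open>d = g\<close> says that \<open>s\<close> induces a function on the residue classes modulo \<open>g\<close>.\<close>

definition cong_pres :: "'a::field poly \<Rightarrow> ('a poly \<Rightarrow> 'a poly) \<Rightarrow> bool" where
  "cong_pres g s \<longleftrightarrow> (\<forall>d h k. d dvd g \<longrightarrow> d dvd h - k \<longrightarrow> d dvd s h - s k)"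

text \<open>Agreement is demanded at every polynomial \<open>h\<close>, not only on
  \<open>reps g\<close>; for \<open>cong_pres\<close> functions and non-constant \<open>g\<close>
  the two requirements are equivalent by \<open>poly_rep_transfer\<close>.\<close>

definition poly_rep :: "'a::field poly \<Rightarrow> ('a poly \<Rightarrow> 'a poly) \<Rightarrow> bool" where
  "poly_rep g s \<longleftrightarrow> (\<exists>F. \<forall>h. g dvd s h - poly F h)"

lemma cong_presD: "cong_pres g s \<Longrightarrow> d dvd g \<Longrightarrow> d dvd h - k \<Longrightarrow> d dvd s h - s k"
  unfolding cong_pres_def by blast

lemma cong_pres_dvd: "cong_pres g s \<Longrightarrow> d dvd g \<Longrightarrow> cong_pres d s"
  unfolding cong_pres_def using dvd_trans by blast

lemma poly_diff_dvd: "x - y dvd poly p x - poly p (y::'a::comm_ring_1)"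
proof (induction p)
  case (pCons a p)
  have "poly (pCons a p) x - poly (pCons a p) y = x * (poly p x - poly p y) + (x - y) * poly p y"
    by (simp add: algebra_simps)
  with pCons.IH show ?case
    by simp
qed simp

text \<open>Both \<open>s\<close> and evaluation of \<open>F\<close> respect congruence modulo
  \<open>g\<close>, so a representing polynomial has to be checked at only one representative of
  each class.\<close>

lemma poly_rep_transfer:
  assumes "cong_pres g s" "g dvd h - k" "g dvd s k - poly F k"
  shows "g dvd s h - poly F h"
proof -
  have "g dvd s h - s k"
    using assms by (auto intro: cong_presD)
  moreover have "g dvd poly F h - poly F k"
    using assms(2) poly_diff_dvd dvd_trans by blast
  ultimately have "g dvd (s h - s k) - (poly F h - poly F k) + (s k - poly F k)"
    using assms(3) by (metis dvd_add dvd_diff)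
  then show ?thesis
    by simp
qed

section \<open>Residue classes and functions on representatives\<close>

lemma residue_class_eq_iff: "residue_class g h = residue_class g k \<longleftrightarrow> g dvd h - k"
proof
  assume "residue_class g h = residue_class g k"
  then have "h \<in> residue_class g k"
    by (auto simp: residue_class_def)
  then show "g dvd h - k"
    by (simp add: residue_class_def cong_iff_dvd_diff)
next
  assume "g dvd h - k"
  then have "[h = k] (mod g)"
    by (simp add: cong_iff_dvd_diff)
  then show "residue_class g h = residue_class g k"
    by (auto simp: residue_class_def cong_def)
qed

lemma mem_residue_class_iff: "u \<in> residue_class g h \<longleftrightarrow> g dvd u - h"
  by (simp add: residue_class_def cong_iff_dvd_diff)

lemma mod_in_reps: "degree g > 0 \<Longrightarrow> h mod g \<in> reps g"
  using degree_mod_less[of g h] by (cases "g = 0") (auto simp: reps_def)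

lemma dvd_minus_mod_self: "g dvd h - h mod (g::'a::field poly)"
  by (simp add: minus_mod_eq_mult_div)

text \<open>A function on classes corresponds to a function \<open>s\<close> on polynomials that
  picks a representative of each value. Any choice works because every modulus \<open>d\<close>
  divides \<open>g\<close>; later arguments thus avoid quotient sets.\<close>

lemma Chen_pair_self_iff:
  fixes g :: "'a::field poly"
  assumes g: "degree g > 0"
  shows "Chen_pair g g \<longleftrightarrow> (\<forall>s. cong_pres g s \<longrightarrow> poly_rep g s)"
proof (intro iffI allI impI)
  fix s assume C: "Chen_pair g g" and s: "cong_pres g s"
  define \<sigma> where "\<sigma> = (\<lambda>C. residue_class g (s (SOME h. h \<in> C)))"
  have \<sigma>: "\<sigma> (residue_class g h) = residue_class g (s h)" for h
  proof -
    have "h \<in> residue_class g h"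
      by (simp add: mem_residue_class_iff)
    then have "(SOME k. k \<in> residue_class g h) \<in> residue_class g h"
      by (rule someI)
    then show ?thesis
      unfolding \<sigma>_def residue_class_eq_iff using cong_presD[OF s dvd_refl]
      by (simp add: mem_residue_class_iff)
  qed
  have "\<sigma> \<in> residue_classes g \<rightarrow> residue_classes g"
    by (auto simp: residue_classes_def \<sigma>)
  moreover have "congruence_preserving g g \<sigma>"
    unfolding congruence_preserving_def \<sigma> mem_residue_class_iff cong_iff_dvd_diff
  proof (intro ballI allI impI)
    fix h k d u v
    assume d: "d dvd g" "d dvd h - k" and uv: "u \<in> residue_class g (s h)" "v \<in> residue_class g (s k)"
    then have "d dvd u - s h" "d dvd v - s k" "d dvd s h - s k"
      using cong_presD[OF s d] by (auto simp: mem_residue_class_iff intro: dvd_trans)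
    then have "d dvd (u - s h) + (s h - s k) - (v - s k)"
      by (metis dvd_add dvd_diff)
    then show "d dvd u - v"
      by simp
  qed
  ultimately obtain F where F: "\<And>h. h \<in> reps g \<Longrightarrow> g dvd s h - poly F h"
    using C unfolding Chen_pair_def polynomial_function_def \<sigma> residue_class_eq_iff
    by (metis \<sigma> residue_class_eq_iff)
  have "g dvd s h - poly F h" for h
    by (rule poly_rep_transfer[OF s dvd_minus_mod_self F[OF mod_in_reps[OF g]]])
  then show "poly_rep g s"
    unfolding poly_rep_def by blast
next
  assume L: "\<forall>s. cong_pres g s \<longrightarrow> poly_rep g s"
  show "Chen_pair g g"
    unfolding Chen_pair_def
  proof (intro ballI impI)
    fix \<sigma> assume "\<sigma> \<in> residue_classes g \<rightarrow> residue_classes g"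
      and cp: "congruence_preserving g g \<sigma>"
    then have "\<exists>u. \<sigma> (residue_class g h) = residue_class g u" for h
      by (auto simp: residue_classes_def Pi_iff)
    then obtain s where s: "\<And>h. \<sigma> (residue_class g h) = residue_class g (s h)"
      by metis
    have "cong_pres g s"
      unfolding cong_pres_def
    proof (intro allI impI)
      fix d h k assume d: "d dvd g" "d dvd h - k"
      \<comment> \<open>\<open>cp\<close> speaks only of elements of \<open>reps g\<close>, so
        \<open>h\<close> and \<open>k\<close> are replaced by their remainders, which lie in the
        same classes modulo \<open>g\<close>.\<close>
      have mod: "residue_class g (h mod g) = residue_class g h" for h
        using dvd_minus_mod_self[of g h] by (simp add: residue_class_eq_iff dvd_diff_commute)
      have "d dvd (h - k) - (h - h mod g) + (k - k mod g)"
        by (intro dvd_add dvd_diff d dvd_trans[OF d(1)] dvd_minus_mod_self)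
      then have "[h mod g = k mod g] (mod d)"
        by (simp add: cong_iff_dvd_diff)
      moreover have "s h \<in> \<sigma> (residue_class g (h mod g))" "s k \<in> \<sigma> (residue_class g (k mod g))"
        by (simp_all add: mod s mem_residue_class_iff)
      ultimately show "d dvd s h - s k"
        using cp d(1) mod_in_reps[OF g] unfolding congruence_preserving_def cong_iff_dvd_diff
        by blast
    qed
    with L show "polynomial_function g g \<sigma>"
      unfolding polynomial_function_def poly_rep_def s residue_class_eq_iff by blast
  qed
qed

section \<open>Inverses modulo prime powers and gluing of coprime moduli\<close>

text \<open>A nonzero element of least degree in the ideal generated by \<open>P\<close> and
  \<open>b\<close> divides the whole ideal, since remainders stay in the ideal. As a common divisor
  of \<open>P\<close> and \<open>b\<close> it is a unit.\<close>

lemma irreducible_bezout: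
  fixes P b :: "'a::field poly"
  assumes P: "irreducible P" and b: "\<not> P dvd b"
  obtains y where "P dvd 1 - b * y"
proof -
  define I where "I = {d. d \<noteq> 0 \<and> (\<exists>x y. d = P * x + b * y)}"
  have "P \<noteq> 0" "P = P * 1 + b * 0"
    using P by (auto simp: irreducible_def)
  then have "P \<in> I"
    unfolding I_def by blast
  then obtain d where d: "d \<in> I" and min: "\<And>e. e \<in> I \<Longrightarrow> degree d \<le> degree e"
    using exists_least_iff[of "\<lambda>n. \<exists>d\<in>I. degree d = n"] by (metis linorder_not_le)
  obtain x y where dxy: "d = P * x + b * y"
    using d unfolding I_def by blast
  have dvd: "d dvd P * v + b * w" for v w
  proof -
    define q where "q = (P * v + b * w) div d"
    have "(P * v + b * w) mod d = P * v + b * w - d * q"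
      by (simp add: q_def minus_mult_div_eq_mod)
    also have "\<dots> = P * (v - x * q) + b * (w - y * q)"
      by (simp add: dxy algebra_simps)
    finally have "(P * v + b * w) mod d \<in> I" if "(P * v + b * w) mod d \<noteq> 0"
      using that unfolding I_def by blast
    moreover have "(P * v + b * w) mod d \<noteq> 0 \<Longrightarrow> degree ((P * v + b * w) mod d) < degree d"
      using d degree_mod_less[of d "P * v + b * w"] by (auto simp: I_def)
    ultimately show ?thesis
      using min by (metis dvd_eq_mod_eq_0 linorder_not_le)
  qed
  from dvd[of 1 0] dvd[of 0 1] have "d dvd P" "d dvd b"
    by simp_all
  then have "is_unit d"
    using P b by (metis dvd_trans irreducible_altdef)
  then obtain e where "1 = d * e"
    by (auto elim: dvdE)
  then have "1 - b * (y * e) = P * (x * e)"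
    by (simp add: dxy algebra_simps)
  then show ?thesis
    using that[of "y * e"] by simp
qed

text \<open>Elements of the form \<open>1 - b * y\<close> are closed under multiplication, so
  factors \<open>P\<close> can be accumulated one at a time.\<close>

lemma irreducible_power_bezout:
  fixes P b :: "'a::field poly"
  assumes P: "irreducible P" and b: "\<not> P dvd b"
  obtains y where "P ^ n dvd 1 - b * y"
proof -
  obtain z where z: "P dvd 1 - b * z"
    using irreducible_bezout[OF P b] .
  have "\<exists>y. P ^ n dvd 1 - b * y"
  proof (induction n)
    case (Suc n)
    then obtain y where "P ^ n dvd 1 - b * y" ..
    with z have "P ^ Suc n dvd (1 - b * z) * (1 - b * y)"
      by (simp add: mult_dvd_mono)
    also have "(1 - b * z) * (1 - b * y) = 1 - b * (z + y - b * z * y)"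
      by (simp add: algebra_simps)
    finally show ?case ..
  qed simp
  with that show ?thesis
    by blast
qed

text \<open>\<open>r * y\<close> is 1 modulo \<open>P ^ n\<close> and 0 modulo \<open>r\<close>.
  With these Chinese remainder idempotents as coefficients, the combination agrees with
  \<open>F\<close> modulo \<open>P ^ n\<close> and with \<open>G\<close> modulo
  \<open>r\<close>.\<close>

lemma poly_rep_mult:
  fixes P r :: "'a::field poly"
  assumes P: "irreducible P" and r: "\<not> P dvd r"
    and "poly_rep (P ^ n) s" "poly_rep r s"
  shows "poly_rep (P ^ n * r) s"
proof -
  obtain F G where F: "\<And>h. P ^ n dvd s h - poly F h" and G: "\<And>h. r dvd s h - poly G h"
    using assms(3,4) unfolding poly_rep_def by blast
  obtain y where y: "P ^ n dvd 1 - r * y"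
    using irreducible_power_bezout[OF P r] .
  have "P ^ n * r dvd s h - poly (smult (r * y) F + smult (1 - r * y) G) h" for h
  proof -
    have "s h - poly (smult (r * y) F + smult (1 - r * y) G) h
        = (s h - poly F h) * (r * y) + (1 - r * y) * (s h - poly G h)"
      by (simp add: algebra_simps)
    moreover have "P ^ n * r dvd (s h - poly F h) * (r * y)"
      using F by (intro mult_dvd_mono) simp_all
    moreover have "P ^ n * r dvd (1 - r * y) * (s h - poly G h)"
      using y G by (intro mult_dvd_mono) simp_all
    ultimately show ?thesis
      by simp
  qed
  then show ?thesis
    unfolding poly_rep_def by blast
qed

section \<open>Interpolation modulo an irreducible polynomial\<close>

lemma prime_elem_dvd_prodE:
  assumes "prime_elem p" "p dvd prod f A"
  obtains a where "a \<in> A" "p dvd f a"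
proof -
  have "\<exists>a\<in>A. p dvd f a"
    using assms(2)
    by (induction A rule: infinite_finite_induct)
      (use assms(1) in \<open>auto simp: prime_elem_dvd_mult_iff dest: prime_elem_not_unit\<close>)
  with that show ?thesis
    by blast
qed

text \<open>Nodes are added one by one. \<open>L\<close> vanishes at the old nodes, and its value at
  the new node is invertible modulo \<open>P\<close> because the nodes are pairwise incongruent; so
  a multiple of \<open>L\<close> corrects the new value.\<close>

lemma lagrange_mod_irreducible:
  fixes P :: "'a::field poly"
  assumes P: "irreducible P" and "finite A"
    and "\<And>a b. a \<in> A \<Longrightarrow> b \<in> A \<Longrightarrow> P dvd a - b \<Longrightarrow> a = b"
  shows "\<exists>F. \<forall>a\<in>A. P dvd s a - poly F a"
  using assms(2,3)
proof (induction A rule: finite_induct)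
  case (insert b A)
  then obtain F where F: "\<And>a. a \<in> A \<Longrightarrow> P dvd s a - poly F a"
    by (metis insertCI)
  define L where "L = (\<Prod>a\<in>A. [:-a, 1:])"
  have "\<not> P dvd poly L b"
  proof
    assume "P dvd poly L b"
    then have "P dvd (\<Prod>a\<in>A. b - a)"
      by (simp add: L_def poly_prod)
    then obtain a where "a \<in> A" "P dvd b - a"
      using prime_elem_dvd_prodE[OF field_poly_irreducible_imp_prime[OF P]] by metis
    with insert.prems[of b a] insert.hyps show False
      by auto
  qed
  then obtain y where "P dvd 1 - poly L b * y"
    using irreducible_bezout[OF P] by blast
  then have "P dvd (s b - poly F b) * (1 - poly L b * y)"
    by simp
  then have "P dvd s b - poly (F + smult (y * (s b - poly F b)) L) b"
    by (simp add: algebra_simps)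
  moreover have "poly L a = 0" if "a \<in> A" for a
    using that insert(1) by (auto simp: L_def poly_prod)
  ultimately have "\<forall>a\<in>insert b A. P dvd s a - poly (F + smult (y * (s b - poly F b)) L) a"
    using F by simp
  then show ?case ..
qed simp

lemma finite_reps: "finite (reps (g :: 'a::{field,finite} poly))"
proof (rule finite_subset)
  show "reps g \<subseteq> Poly ` {xs. set xs \<subseteq> UNIV \<and> length xs \<le> Suc (degree g)}"
  proof
    fix p assume "p \<in> reps g"
    then have "length (coeffs p) \<le> Suc (degree g)"
      by (cases "p = 0") (auto simp: reps_def length_coeffs)
    then show "p \<in> Poly ` {xs. set xs \<subseteq> UNIV \<and> length xs \<le> Suc (degree g)}"
      by (intro image_eqI[of _ _ "coeffs p"]) simp_all
  qed
  show "finite (Poly ` {xs :: 'a list. set xs \<subseteq> UNIV \<and> length xs \<le> Suc (degree g)})"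
    by (intro finite_imageI finite_lists_length_le finite)
qed

lemma irreducible_degree_pos: "irreducible (P :: 'a::field poly) \<Longrightarrow> degree P > 0"
  by (metis irreducible_not_unit is_unit_iff_degree irreducible_def gr0I)

lemma poly_rep_irreducible:
  fixes P :: "'a::{field,finite} poly"
  assumes P: "irreducible P" and s: "cong_pres P s"
  shows "poly_rep P s"
proof -
  have deg: "degree P > 0"
    by (rule irreducible_degree_pos[OF P])
  have "a = b" if "a \<in> reps P" "b \<in> reps P" "P dvd a - b" for a b
  proof -
    have "degree (a - b) < degree P"
      using that(1,2) deg by (auto simp: reps_def intro: degree_diff_less)
    then show ?thesis
      using that(3) dvd_imp_degree_le[of P "a - b"] by fastforce
  qed
  then obtain F where "\<And>a. a \<in> reps P \<Longrightarrow> P dvd s a - poly F a"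
    using lagrange_mod_irreducible[OF P finite_reps, of P s] by blast
  then have "P dvd s h - poly F h" for h
    using poly_rep_transfer[OF s dvd_minus_mod_self] mod_in_reps[OF deg] by blast
  then show ?thesis
    unfolding poly_rep_def by blast
qed

section \<open>Interpolation modulo the square of an irreducible polynomial\<close>

lemma poly_rep_square:
  fixes P :: "'a::field poly"
  assumes P: "\<And>u. P dvd u \<or> P dvd u - 1" and s: "cong_pres (P\<^sup>2) s"
  shows "poly_rep (P\<^sup>2) s"
proof -
  define a where "a = s 0"
  define b where "b = s 1"
  have "P dvd s P - a"
    using cong_presD[OF s, of P P 0] by (simp add: a_def)
  then obtain \<alpha> where "s P - a = P * \<alpha>" ..
  then have \<alpha>: "s P = a + P * \<alpha>"
    by (simp add: algebra_simps)
  have "P dvd s (1 + P) - b"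
    using cong_presD[OF s, of P "1 + P" 1] by (simp add: b_def)
  then obtain \<beta> where "s (1 + P) - b = P * \<beta>" ..
  then have \<beta>: "s (1 + P) = b + P * \<beta>"
    by (simp add: algebra_simps)
  \<comment> \<open>\<open>c\<close> and \<open>d\<close> solve the conditions at \<open>P\<close>
    and \<open>1 + P\<close>: modulo \<open>P ^ 2\<close>, the values of \<open>F\<close> there are
    \<open>a + P * (b - a - c)\<close> and \<open>b + P * (b - a + c + d)\<close>.\<close>
  define c where "c = b - a - \<alpha>"
  define d where "d = \<beta> - (b - a) - c"
  define F where "F = [:a:] + smult (b - a) [:0, 1:] + smult c ([:0, 1:] * [:-1, 1:])
    + smult d ([:0, 1:] * [:-1, 1:] * [:-P, 1:])"
  have F: "poly F x = a + (b - a) * x + c * (x * (x - 1)) + d * (x * (x - 1) * (x - P))" for x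
    by (simp add: F_def algebra_simps)
  have "P\<^sup>2 dvd s P - poly F P"
    unfolding F \<alpha> by (rule dvdI[of _ _ "- c"]) (simp add: c_def algebra_simps power2_eq_square)
  moreover have "P\<^sup>2 dvd s (1 + P) - poly F (1 + P)"
    unfolding F \<beta> by (rule dvdI[of _ _ "- c - d"]) (simp add: d_def algebra_simps power2_eq_square)
  moreover have "P\<^sup>2 dvd s 0 - poly F 0" "P\<^sup>2 dvd s 1 - poly F 1"
    by (simp_all add: F a_def b_def)
  ultimately have base: "P\<^sup>2 dvd s k - poly F k" if "k \<in> {0, 1, P, 1 + P}" for k
    using that by blast
  \<comment> \<open>The lowest base-\<open>P\<close> digit can be taken in \<open>{0, 1}\<close>;
    extracting two digits reduces any \<open>h\<close> modulo \<open>P ^ 2\<close> to one of the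
    four nodes.\<close>
  have digit: "\<exists>e u. e \<in> {0, 1} \<and> h = e + P * u" for h
  proof -
    obtain e where "e \<in> {0, 1}" "P dvd h - e"
      using P[of h] by (metis diff_zero insertCI)
    then show ?thesis
      by (metis add_diff_cancel_left' diff_add_cancel dvdE add.commute)
  qed
  have "P\<^sup>2 dvd s h - poly F h" for h
  proof -
    obtain e u where e: "e \<in> {0, 1}" "h = e + P * u"
      using digit by blast
    obtain e' u' where e': "e' \<in> {0, 1}" "u = e' + P * u'"
      using digit by blast
    have "h - (e + P * e') = P\<^sup>2 * u'"
      by (simp add: e e' algebra_simps power2_eq_square)
    then have "P\<^sup>2 dvd h - (e + P * e')"
      by simp
    moreover have "e + P * e' \<in> {0, 1, P, 1 + P}"
      using e(1) e'(1) by auto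
    ultimately show ?thesis
      using poly_rep_transfer[OF s] base by blast
  qed
  then show ?thesis
    unfolding poly_rep_def by blast
qed

section \<open>Sufficiency by splitting off prime powers\<close>

lemma irreducible_factor_exists:
  fixes g :: "'a::field poly"
  assumes "degree g > 0"
  obtains P where "irreducible P" "P dvd g"
proof -
  have "\<exists>P. irreducible P \<and> P dvd g"
    using assms
  proof (induction "degree g" arbitrary: g rule: less_induct)
    case less
    show ?case
    proof (cases "irreducible g")
      case False
      have "g \<noteq> 0"
        using less.prems by auto
      then have "\<not> is_unit g"
        using less.prems by (simp add: is_unit_iff_degree)
      with False \<open>g \<noteq> 0\<close> obtain a b where ab: "g = a * b" "\<not> is_unit a" "\<not> is_unit b"
        by (auto simp: irreducible_def)
      with \<open>g \<noteq> 0\<close> have "degree a > 0" "degree b > 0" "degree g = degree a + degree b"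
        by (auto simp: is_unit_iff_degree degree_mult_eq)
      with less.hyps[of a] ab(1) show ?thesis
        by (metis dvd_mult2 less_add_same_cancel1)
    qed (use dvd_refl in blast)
  qed
  with that show ?thesis
    by blast
qed

lemma split_off_power:
  fixes g P :: "'a::field poly"
  assumes "g \<noteq> 0" "degree P > 0"
  shows "\<exists>k r. g = P ^ k * r \<and> \<not> P dvd r"
  using assms(1)
proof (induction "degree g" arbitrary: g rule: less_induct)
  case less
  show ?case
  proof (cases "P dvd g")
    case True
    then obtain h where h: "g = P * h" ..
    with less.prems assms(2) have "h \<noteq> 0" "degree h < degree g"
      by (auto simp: degree_mult_eq)
    with less.hyps obtain k r where "h = P ^ k * r" "\<not> P dvd r"
      by blast
    with h have "g = P ^ Suc k * r"
      by (simp add: mult.assoc)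
    with \<open>\<not> P dvd r\<close> show ?thesis
      by blast
  next
    case False
    then have "g = P ^ 0 * g"
      by simp
    with False show ?thesis
      by blast
  qed
qed

text \<open>Induction on the degree removes an exact prime power \<open>P ^ k\<close>. The
  hypothesis leaves \<open>k = 1\<close>, or \<open>k = 2\<close> with residue field
  \<open>{0, 1}\<close>, both settled by interpolation, and it passes to the cofactor
  \<open>r\<close>.\<close>

lemma poly_rep_of_cong_pres:
  fixes g :: "'a::{field,finite} poly"
  assumes "g \<noteq> 0"
    and "\<And>P. irreducible P \<Longrightarrow> P\<^sup>2 dvd g \<Longrightarrow> (\<forall>u. P dvd u \<or> P dvd u - 1) \<and> \<not> P ^ 3 dvd g"
    and "cong_pres g s"
  shows "poly_rep g s"
  using assms
proof (induction "degree g" arbitrary: g rule: less_induct)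
  case less
  show ?case
  proof (cases "degree g = 0")
    case True
    with less.prems(1) have "g dvd s h - poly 0 h" for h
      by (auto simp: is_unit_iff_degree intro: unit_imp_dvd)
    then show ?thesis
      unfolding poly_rep_def by blast
  next
    case False
    then obtain P where P: "irreducible P" "P dvd g"
      using irreducible_factor_exists by blast
    note degP = irreducible_degree_pos[OF P(1)]
    obtain k r where g: "g = P ^ k * r" and r: "\<not> P dvd r"
      using split_off_power[OF less.prems(1) degP] by blast
    have "k > 0"
      using P(2) g r by (metis gr0I mult_1 power_0)
    have dvd_g: "P ^ n dvd g" if "n \<le> k" for n
      using that by (simp add: g le_imp_power_dvd)
    have "\<not> k \<ge> 3"
      using less.prems(2)[OF P(1)] dvd_g[of 2] dvd_g[of 3] by auto
    with \<open>k > 0\<close> consider "k = 1" | "k = 2"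
      by linarith
    then have "poly_rep (P ^ k) s"
    proof cases
      case 1
      then show ?thesis
        using poly_rep_irreducible[OF P(1) cong_pres_dvd[OF less.prems(3) P(2)]] by simp
    next
      case 2
      then have "P\<^sup>2 dvd g"
        by (simp add: g)
      with 2 less.prems(2)[OF P(1)] show ?thesis
        using poly_rep_square cong_pres_dvd[OF less.prems(3)] by blast
    qed
    moreover have "poly_rep r s"
    proof (rule less.hyps)
      have "r dvd g"
        by (simp add: g)
      show "r \<noteq> 0"
        using r by auto
      then show "degree r < degree g"
        using g \<open>k > 0\<close> degP less.prems(1) by (auto simp: degree_mult_eq degree_power_eq)
      show "cong_pres r s"
        using less.prems(3) \<open>r dvd g\<close> by (rule cong_pres_dvd)
      show "(\<forall>u. Q dvd u \<or> Q dvd u - 1) \<and> \<not> Q ^ 3 dvd r" if "irreducible Q" "Q\<^sup>2 dvd r" for Q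
        using less.prems(2)[OF that(1)] that(2) \<open>r dvd g\<close> dvd_trans by blast
    qed
    ultimately show ?thesis
      unfolding g using poly_rep_mult[OF P(1) r] by blast
  qed
qed

section \<open>Necessity by a test function\<close>

text \<open>The second-order coefficient is left unspecified instead of being half a second
  derivative, so the expansion also holds in characteristic 2.\<close>

lemma poly_taylor:
  fixes F :: "'a::idom poly"
  shows "\<exists>c. poly F (h + e) = poly F h + e * poly (pderiv F) h + e\<^sup>2 * c"
proof (induction F)
  case (pCons a F)
  from pCons.IH obtain c where c: "poly F (h + e) = poly F h + e * poly (pderiv F) h + e\<^sup>2 * c" ..
  have "poly (pCons a F) (h + e) = poly (pCons a F) h + e * poly (pderiv (pCons a F)) h
      + e\<^sup>2 * (poly (pderiv F) h + (h + e) * c)"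
    by (simp only: poly_pCons pderiv_pCons poly_add c) (simp add: algebra_simps power2_eq_square)
  then show ?case ..
qed simp

text \<open>Write \<open>g = P ^ k * r\<close> with \<open>k \<ge> 2\<close> and \<open>P\<close> not dividing \<open>r\<close>. The test function takes
  the value \<open>P ^ (k - 1) * r\<close> on the class of \<open>P ^ (k - 1)\<close> modulo \<open>P ^ k\<close>, and vanishes elsewhere.
  A polynomial \<open>F\<close> representing it has derivative nonzero modulo \<open>P\<close> at \<open>0\<close>, hence at every multiple
  of \<open>P\<close>, so \<open>F\<close> also varies on other translates of \<open>P ^ (k - 1)\<close> by multiples of \<open>P\<close>.\<close>

lemma square_dvd_poly_rep:
  fixes g :: "'a::field poly"
  assumes g0: "g \<noteq> 0" and P: "irreducible P" and sq: "P\<^sup>2 dvd g"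
    and rep: "\<And>s. cong_pres g s \<Longrightarrow> poly_rep g s"
  shows "(\<forall>u. P dvd u \<or> P dvd u - 1) \<and> \<not> P ^ 3 dvd g"
proof -
  note prime = field_poly_irreducible_imp_prime[OF P]
  have P0: "P \<noteq> 0" and Pu: "\<not> is_unit P"
    using P by (auto simp: irreducible_def)
  obtain k r where gk: "g = P ^ k * r" and r: "\<not> P dvd r"
    using split_off_power[OF g0 irreducible_degree_pos[OF P]] by blast
  have le: "n \<le> k" if dvd: "P ^ n dvd g" for n
  proof (rule ccontr)
    assume "\<not> n \<le> k"
    then have "P ^ Suc k dvd P ^ k * r"
      using dvd gk by (metis dvd_trans le_imp_power_dvd not_less_eq_eq)
    then show False
      using r P0 by simp
  qed
  from le[OF sq] obtain j where j: "k = Suc j" "j \<ge> 1"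
    by (cases k) auto
  define Q where "Q = P ^ j"
  have g: "g = P * Q * r" and PQ: "P dvd Q" and Q0: "Q \<noteq> 0"
    using j P0 by (auto simp: gk Q_def dvd_power)
  \<comment> \<open>The factor \<open>r\<close> makes all values agree modulo each divisor of
    \<open>Q * r\<close>, so only divisors of \<open>g\<close> containing the full power
    \<open>P * Q\<close> need attention.\<close>
  define s where "s = (\<lambda>h. if P * Q dvd h - Q then Q * r else 0)"
  have "cong_pres g s"
    unfolding cong_pres_def
  proof (intro allI impI)
    fix d h k assume d: "d dvd g" "d dvd h - k"
    show "d dvd s h - s k"
    proof (cases "d dvd Q * r")
      case False
      \<comment> \<open>\<open>P\<close> cannot divide the cofactor \<open>c\<close>, or
        \<open>d\<close> would divide \<open>Q * r\<close>. With an inverse \<open>y\<close> of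
        \<open>c\<close> modulo \<open>P * Q\<close>, \<open>d = d * (1 - c * y) + g * y\<close>,
        where both terms are multiples of \<open>P * Q\<close>.\<close>
      have "P * Q dvd d"
      proof -
        obtain c where c: "g = d * c"
          using d(1) ..
        have "\<not> P dvd c"
        proof
          assume "P dvd c"
          then obtain c' where "c = P * c'" ..
          with c g P0 have "Q * r = d * c'"
            by (simp add: algebra_simps)
          with False show False
            by simp
        qed
        obtain y where "P ^ Suc j dvd 1 - c * y"
          using irreducible_power_bezout[OF P \<open>\<not> P dvd c\<close>] .
        then have "P * Q dvd d * (1 - c * y)"
          by (simp add: Q_def)
        moreover have "P * Q dvd d * c * y"
          using c g by (metis dvd_mult2 dvd_triv_left)
        ultimately have "P * Q dvd d * (1 - c * y) + d * c * y"
          by (rule dvd_add)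
        then show ?thesis
          by (simp add: algebra_simps)
      qed
      then have "P * Q dvd h - k"
        using d(2) dvd_trans by blast
      then have "P * Q dvd h - Q \<longleftrightarrow> P * Q dvd k - Q"
        using dvd_add_right_iff[of "P * Q" "h - k" "k - Q"] by simp
      then show ?thesis
        by (simp add: s_def)
    qed (simp add: s_def)
  qed
  then obtain F where F: "\<And>h. g dvd s h - poly F h"
    using rep unfolding poly_rep_def by blast
  have F: "P * Q dvd s h - poly F h" for h
    using F[of h] unfolding g by (rule dvd_mult_left)
  define D where "D = poly (pderiv F)"
  \<comment> \<open>The second-order term contains \<open>Q * Q\<close>, which vanishes modulo
    \<open>P * Q\<close> because \<open>P\<close> divides \<open>Q\<close>.\<close>
  have taylor: "P * Q dvd s (h + Q * u) - s h - Q * (u * D h)" for h u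
  proof -
    obtain c where c: "poly F (h + Q * u) = poly F h + Q * u * D h + (Q * u)\<^sup>2 * c"
      unfolding D_def using poly_taylor by blast
    have "P * Q dvd (s (h + Q * u) - poly F (h + Q * u)) - (s h - poly F h) + Q * Q * (u\<^sup>2 * c)"
      using PQ by (intro dvd_add dvd_diff F) (simp add: mult_dvd_mono)
    then show ?thesis
      by (simp add: c algebra_simps power2_eq_square)
  qed
  have cancel: "P dvd x" if "P * Q dvd Q * x" for x
    using that Q0 by (simp add: mult.commute[of P])
  have nd: "\<not> P * Q dvd Q"
    using cancel[of 1] Pu by auto
  have s0: "s 0 = 0" and sQ: "s Q = Q * r"
    using nd by (simp_all add: s_def)
  \<comment> \<open>Passing from \<open>0\<close> to \<open>Q\<close> changes \<open>s\<close> by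
    \<open>Q * r\<close>, which fixes the derivative at \<open>0\<close> modulo
    \<open>P\<close>.\<close>
  have "P dvd r - D 0"
    using taylor[of 0 1] by (intro cancel) (simp add: s0 sQ algebra_simps)
  then have D0: "\<not> P dvd D 0"
    using r by (metis diff_add_cancel dvd_add)
  \<comment> \<open>For a residue \<open>u\<close> other than 0 and 1, \<open>s\<close> vanishes at
    both \<open>0\<close> and \<open>Q * u\<close>, so \<open>P\<close> would divide
    \<open>u * D 0\<close>.\<close>
  have "P dvd u \<or> P dvd u - 1" for u
  proof (rule ccontr)
    assume u: "\<not> (P dvd u \<or> P dvd u - 1)"
    have "\<not> P * Q dvd Q * u - Q"
      using cancel[of "u - 1"] u by (auto simp: algebra_simps)
    then have "s (Q * u) = 0"
      by (simp add: s_def)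
    then have "P dvd u * D 0"
      using taylor[of 0 u] by (intro cancel) (simp add: s0)
    with u D0 prime show False
      by (simp add: prime_elem_dvd_mult_iff)
  qed
  moreover have "\<not> P ^ 3 dvd g"
  proof
    assume "P ^ 3 dvd g"
    then have "j \<ge> 2"
      using le j by fastforce
    \<comment> \<open>This is where the cube enters: for \<open>j = 1\<close> the point
      \<open>P\<close> would be \<open>Q\<close> itself, whereas for \<open>j\<close> at least 2
      both \<open>P\<close> and \<open>P + Q\<close> lie outside the class of
      \<open>Q\<close>.\<close>
    then have P2Q: "P * P dvd Q"
      unfolding Q_def power2_eq_square[symmetric] by (rule le_imp_power_dvd)
    have P2: "\<not> P * P dvd P"
      using P0 Pu by simp
    have "\<not> P * Q dvd P"
      using P2 PQ by (metis dvd_refl dvd_trans mult_dvd_mono)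
    moreover have "\<not> P * Q dvd P - Q"
    proof
      assume "P * Q dvd P - Q"
      then have "P * P dvd P - Q"
        using PQ by (metis dvd_refl dvd_trans mult_dvd_mono)
      with P2Q P2 show False
        by (metis diff_add_cancel dvd_add)
    qed
    ultimately have "s P = 0" "s (P + Q) = 0"
      by (simp_all add: s_def)
    \<comment> \<open>\<open>s\<close> does not change from \<open>P\<close> to
      \<open>P + Q\<close>, so the derivative vanishes at \<open>P\<close> modulo \<open>P\<close>,
      contradicting its value at the congruent point \<open>0\<close>.\<close>
    then have "P dvd D P"
      using taylor[of P 1] by (intro cancel) simp
    moreover have "P dvd D P - D 0"
      using poly_diff_dvd[of P 0] by (simp add: D_def)
    ultimately show False
      using D0 by (metis diff_diff_eq2 dvd_diff add_diff_cancel_left')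
  qed
  ultimately show ?thesis
    by blast
qed

section \<open>Two-element residue fields and the final criterion\<close>

text \<open>Polynomials of degree below that of \<open>P\<close> are pairwise incongruent, so the
  left side leaves only 0 and 1 among them. The constants then force a field of two elements, and
  \<open>[:0, 1:]\<close> forces degree 1. Conversely, remainders modulo a linear \<open>P\<close>
  are constants.\<close>

lemma residue_field_two_elements_iff:
  fixes P :: "'a::{field,finite} poly"
  assumes P: "irreducible P"
  shows "(\<forall>u::'a poly. P dvd u \<or> P dvd u - 1) \<longleftrightarrow> CARD('a) = 2 \<and> degree P = 1"
proof
  assume L: "\<forall>u::'a poly. P dvd u \<or> P dvd u - 1"
  have deg: "degree P > 0"
    by (rule irreducible_degree_pos[OF P])
  have small: "u = 0 \<or> u = 1" if "degree u < degree P" for u :: "'a poly"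
  proof -
    have "degree (u - 1) < degree P"
      using that deg by (intro degree_diff_less) simp_all
    then show ?thesis
      using L[rule_format, of u] that
      by (metis dvd_imp_degree_le leD right_minus_eq)
  qed
  have "c = 0 \<or> c = 1" for c :: 'a
    using small[of "[:c:]"] deg by (auto simp: one_pCons)
  then have "(UNIV :: 'a set) = {0, 1}"
    by auto
  then have "CARD('a) = 2"
    by (metis card_2_iff zero_neq_one)
  moreover have "\<not> degree P > 1"
    using small[of "[:0, 1:]"] by (auto simp: one_pCons)
  ultimately show "CARD('a) = 2 \<and> degree P = 1"
    using deg by linarith
next
  assume R: "CARD('a) = 2 \<and> degree P = 1"
  then have U: "{0, 1} = (UNIV :: 'a set)"
    by (intro card_subset_eq) simp_all
  show "\<forall>u::'a poly. P dvd u \<or> P dvd u - 1"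
  proof
    fix u :: "'a poly"
    have "u mod P = 0 \<or> degree (u mod P) = 0"
      using R degree_mod_less[of P u] by force
    then obtain c where c: "u mod P = [:c:]"
      by (metis degree_eq_zeroE degree_0)
    have "P dvd u - [:c:]"
      using dvd_minus_mod_self[of P u] by (simp add: c)
    moreover have "c \<in> {0, 1}"
      by (simp add: U)
    ultimately show "P dvd u \<or> P dvd u - 1"
      by (auto simp: one_pCons)
  qed
qed

lemma Chen_pair_iff_irreducible_squares:
  fixes g :: "'a::{field,finite} poly"
  assumes "degree g > 0"
  shows "Chen_pair g g \<longleftrightarrow>
    (\<forall>P. irreducible P \<and> P\<^sup>2 dvd g \<longrightarrow> CARD('a) = 2 \<and> degree P = 1 \<and> \<not> P ^ 3 dvd g)"
proof -
  have "g \<noteq> 0"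
    using assms by auto
  then show ?thesis
    unfolding Chen_pair_self_iff[OF assms]
    using poly_rep_of_cong_pres[of g] square_dvd_poly_rep[of g] residue_field_two_elements_iff
    by (metis (no_types, lifting))
qed

lemma squarefree_iff_irreducible:
  fixes g :: "'a::field poly"
  assumes "g \<noteq> 0"
  shows "squarefree g \<longleftrightarrow> (\<forall>P. irreducible P \<longrightarrow> \<not> P\<^sup>2 dvd g)"
proof
  assume "squarefree g"
  then show "\<forall>P. irreducible P \<longrightarrow> \<not> P\<^sup>2 dvd g"
    by (auto simp: squarefree_def irreducible_def)
next
  assume L: "\<forall>P. irreducible P \<longrightarrow> \<not> P\<^sup>2 dvd g"
  show "squarefree g"
  proof (rule squarefreeI, rule ccontr)
    fix x assume x: "x\<^sup>2 dvd g" "\<not> is_unit x"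
    with assms have "degree x > 0"
      by (auto simp: is_unit_iff_degree)
    then obtain P where "irreducible P" "P dvd x"
      using irreducible_factor_exists by blast
    with L x show False
      using dvd_power_same dvd_trans by blast
  qed
qed

theorem corollary1p9:
  fixes g :: "'a::{field,finite} poly"
  assumes "degree g > 0"
  shows "Chen_pair g g \<longleftrightarrow>
    (CARD('a) = 2 \<and> \<not> [:0, 1:] ^ 3 dvd g \<and> \<not> ([:0, 1:] + 1) ^ 3 dvd g \<and>
       (\<forall>P :: 'a poly. irreducible P \<and> degree P \<ge> 2 \<longrightarrow> \<not> P ^ 2 dvd g)) \<or>
    (CARD('a) > 2 \<and> squarefree g)"
proof (cases "CARD('a) = 2")
  case False
  have "card {0, 1 :: 'a} \<le> CARD('a)"
    by (intro card_mono) simp_all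
  with False have "CARD('a) > 2"
    by simp
  moreover have "g \<noteq> 0"
    using assms by auto
  \<comment> \<open>Since \<open>CARD('a) = 2\<close> fails, the criterion forbids every irreducible
    square divisor.\<close>
  ultimately show ?thesis
    using False by (simp add: Chen_pair_iff_irreducible_squares[OF assms] squarefree_iff_irreducible)
next
  case True
  then have U: "{0, 1} = (UNIV :: 'a set)"
    by (intro card_subset_eq) simp_all
  \<comment> \<open>Over the field of two elements only two linear polynomials exist, so the cube
    condition concerns just these.\<close>
  have linear: "P = [:0, 1:] \<or> P = [:0, 1:] + 1" if P: "degree P = 1" for P :: "'a poly"
  proof -
    obtain a b where ab: "P = [:a, b:]" "b \<noteq> 0"
      using degree1_coeffs[OF P] by blast
    moreover have "a \<in> {0, 1}" "b \<in> {0, 1}"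
      by (simp_all add: U)
    ultimately show ?thesis
      by (auto simp: one_pCons)
  qed
  have irred: "irreducible [:0, 1 :: 'a:]" "irreducible ([:0, 1 :: 'a:] + 1)"
    by (simp_all add: one_pCons irreducible_linear_field_poly)
  \<comment> \<open>A cube divisor supplies the square divisor that the criterion takes as its
    premise.\<close>
  have sq: "P\<^sup>2 dvd g" if "P ^ 3 dvd g" for P
    using that le_imp_power_dvd[of 2 3 P] dvd_trans by fastforce
  have pos: "degree P = 1 \<or> degree P \<ge> 2" if "irreducible P" for P :: "'a poly"
    using irreducible_degree_pos[OF that] by linarith
  show ?thesis
    unfolding Chen_pair_iff_irreducible_squares[OF assms]
  proof (intro iffI)
    assume L: "\<forall>P. irreducible P \<and> P\<^sup>2 dvd g \<longrightarrow> CARD('a) = 2 \<and> degree P = 1 \<and> \<not> P ^ 3 dvd g"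
    have "\<not> P\<^sup>2 dvd g" if "irreducible P" "degree P \<ge> 2" for P
      using L that by fastforce
    with True L irred sq show "(CARD('a) = 2 \<and> \<not> [:0, 1:] ^ 3 dvd g \<and> \<not> ([:0, 1:] + 1) ^ 3 dvd g \<and>
       (\<forall>P :: 'a poly. irreducible P \<and> degree P \<ge> 2 \<longrightarrow> \<not> P ^ 2 dvd g)) \<or>
      (CARD('a) > 2 \<and> squarefree g)"
      by blast
  next
    assume "(CARD('a) = 2 \<and> \<not> [:0, 1:] ^ 3 dvd g \<and> \<not> ([:0, 1:] + 1) ^ 3 dvd g \<and>
       (\<forall>P :: 'a poly. irreducible P \<and> degree P \<ge> 2 \<longrightarrow> \<not> P ^ 2 dvd g)) \<or>
      (CARD('a) > 2 \<and> squarefree g)"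
    with True linear pos
    show "\<forall>P. irreducible P \<and> P\<^sup>2 dvd g \<longrightarrow> CARD('a) = 2 \<and> degree P = 1 \<and> \<not> P ^ 3 dvd g"
      by (metis less_irrefl)
  qed
qed

end
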